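(* Let $W$ be ULC($n$) with support $\{0,1,\ldots,n\}$ and mean $nr>0$. Let $Z\sim\mathrm{Bin}(n,r)$ and let $Y_1,Y_2,\ldots$ be iid non-negative, integer-valued random variables (independent of $W$ and of $Z$). Let $$\widehat{W}=\sum_{i=1}^WY_i,\qquad\widehat{Z}=\sum_{i=1}^ZY_i.$$ If $\widehat{Z}$ is log-concave, then $H(\widehat{W})\leq H(\widehat{Z})$.
   Context: $n\geq1$ is an integer. The support of $W$ is the set of $i$ with $\mathbb{P}(W=i)>0$. A random variable $X$ supported on $\{0,1,\ldots,n\}$ is ULC($n$) (ultra log-concave of degree $n$) if $\frac{\mathbb{P}(X=i+1)^2}{\binom{n}{i+1}^2}\geq\frac{\mathbb{P}(X=i)}{\binom{n}{i}}\frac{\mathbb{P}(X=i+2)}{\binom{n}{i+2}}$ for $0\leq i\leq n-2$. A non-negative integer-valued random variable $X$ is log-concave if its support is an interval in $\{0,1,2,\ldots\}$ and $\mathbb{P}(X=i)^2\geq\mathbb{P}(X=i-1)\mathbb{P}(X=i+1)$ for all integers $i\geq1$. The entropy is $H(X)=-\sum_{i=0}^\infty\mathbb{P}(X=i)\log\mathbb{P}(X=i)$ (natural logarithm, $0\log0=0$). *)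

theory Defs
  imports "HOL-Probability.Probability"
begin

definition support :: "'a measure \<Rightarrow> ('a \<Rightarrow> nat) \<Rightarrow> nat set" where
  "support M X = {i. \<P>(\<omega> in M. X \<omega> = i) > 0}"

definition ULC :: "'a measure \<Rightarrow> nat \<Rightarrow> ('a \<Rightarrow> nat) \<Rightarrow> bool" where
  "ULC M n X \<longleftrightarrow>
     support M X \<subseteq> {0..n} \<and>
     (\<forall>i. i + 2 \<le> n \<longrightarrow>
        \<P>(\<omega> in M. X \<omega> = i + 1)\<^sup>2 / (real (n choose (i + 1)))\<^sup>2
          \<ge> (\<P>(\<omega> in M. X \<omega> = i) / real (n choose i)) *
            (\<P>(\<omega> in M. X \<omega> = i + 2) / real (n choose (i + 2))))"

definition log_concave :: "'a measure \<Rightarrow> ('a \<Rightarrow> nat) \<Rightarrow> bool" where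
  "log_concave M X \<longleftrightarrow>
     (\<forall>i\<in>support M X. \<forall>k\<in>support M X. {i..k} \<subseteq> support M X) \<and>
     (\<forall>i\<ge>1. \<P>(\<omega> in M. X \<omega> = i)\<^sup>2
        \<ge> \<P>(\<omega> in M. X \<omega> = i - 1) * \<P>(\<omega> in M. X \<omega> = i + 1))"

text \<open>The entropy of a random variable with values in the natural numbers may be infinite,
  so it is extended-real valued. Every summand is non-negative because probabilities are at
  most 1, so no term is truncated by \<^const>\<open>ennreal\<close>; a vanishing probability contributes 0.\<close>

definition entropy_nat :: "'a measure \<Rightarrow> ('a \<Rightarrow> nat) \<Rightarrow> ennreal" where
  "entropy_nat M X =
     (\<Sum>i. ennreal (- (\<P>(\<omega> in M. X \<omega> = i) * ln (\<P>(\<omega> in M. X \<omega> = i)))))"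

definition random_sum :: "('a \<Rightarrow> nat) \<Rightarrow> (nat \<Rightarrow> 'a \<Rightarrow> nat) \<Rightarrow> 'a \<Rightarrow> nat" where
  "random_sum N Y \<omega> = (\<Sum>i=1..N \<omega>. Y i \<omega>)"

definition iid :: "'a measure \<Rightarrow> (nat \<Rightarrow> 'a \<Rightarrow> nat) \<Rightarrow> bool" where
  "iid M Y \<longleftrightarrow>
     prob_space.indep_vars M (\<lambda>_. count_space UNIV) Y {1..} \<and>
     (\<forall>i\<ge>1. distr M (count_space UNIV) (Y i) = distr M (count_space UNIV) (Y 1))"

text \<open>The library's \<open>indep_var\<close> requires both random variables to have the same value type;
  this is its characterization \<open>indep_var_eq\<close> for two value types.\<close>

definition indep_rv ::
  "'a measure \<Rightarrow> 'b measure \<Rightarrow> ('a \<Rightarrow> 'b) \<Rightarrow> 'c measure \<Rightarrow> ('a \<Rightarrow> 'c) \<Rightarrow> bool" where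
  "indep_rv M S X T Y \<longleftrightarrow>
     X \<in> measurable M S \<and> Y \<in> measurable M T \<and>
     prob_space.indep_set M
       (sigma_sets (space M) {X -` A \<inter> space M | A. A \<in> sets S})
       (sigma_sets (space M) {Y -` A \<inter> space M | A. A \<in> sets T})"

text \<open>The sequence \<open>Y 1, Y 2, \<dots>\<close> is independent of \<open>N\<close> as a whole, i.e. as one random element of
  the product space, not merely term by term.\<close>

definition indep_of_seq :: "'a measure \<Rightarrow> ('a \<Rightarrow> nat) \<Rightarrow> (nat \<Rightarrow> 'a \<Rightarrow> nat) \<Rightarrow> bool" where
  "indep_of_seq M N Y \<longleftrightarrow>
     indep_rv M (count_space UNIV) N
       (PiM {1..} (\<lambda>_. count_space UNIV)) (\<lambda>\<omega>. \<lambda>i\<in>{1..}. Y i \<omega>)"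

end

theory Submission
  imports Defs
begin

text \<open>
  Write \<open>f\<close> and \<open>g\<close> for the mass functions of the random sums over \<open>W\<close> and over \<open>Z\<close>, put
  \<open>L = - ln g\<close>, and let \<open>S\<^sub>j = Y\<^sub>1 + \<dots> + Y\<^sub>j\<close>. The entropy of \<open>g\<close> is the mean of \<open>L\<close> under \<open>g\<close>,
  and by Gibbs' inequality the entropy of \<open>f\<close> is at most the mean of \<open>L\<close> under \<open>f\<close>
  (\<open>entropy_nat_le_cross_entropy\<close>). It is therefore enough to compare two means of the same
  function. Conditioning on the number of summands turns them into the means of
  \<open>E j = \<integral> L(S\<^sub>j)\<close> under the laws of \<open>W\<close> and \<open>Z\<close> (\<open>expectation_random_sum\<close>).

  Log-concavity of \<open>g\<close> says that \<open>L\<close> is convex on the support of \<open>g\<close>. Convexity passes from \<open>L\<close> to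
  \<open>E\<close>: whenever \<open>s\<close> and \<open>s + a + b\<close> lie in the support, which is an interval,
  \<open>L(s + a) + L(s + b) \<le> L s + L(s + a + b)\<close>, and if
  \<open>s = S\<^sub>m\<close>, \<open>a = Y\<^sub>m\<^sub>+\<^sub>1\<close>, \<open>b = Y\<^sub>m\<^sub>+\<^sub>2\<close>, then \<open>s + a\<close> and \<open>s + b\<close> both have the law of
  \<open>S\<^sub>m\<^sub>+\<^sub>1\<close> (\<open>expectation_partial_sum_convex\<close>).

  Finally, \<open>W\<close> is smaller than \<open>Z\<close> in the convex order (\<open>ULC_sum_convex_le_binomial\<close>). Ultra
  log-concavity means exactly that the ratio of the two mass functions is log-concave, so the set
  where \<open>W\<close> has more mass than \<open>Z\<close> is an interval. Equal mass and equal mean allow an affine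
  function to be subtracted from \<open>E\<close>; the chord of \<open>E\<close> over that interval makes every term of the
  difference of the two means nonnegative (\<open>log_concave_ratio_sum_convex_le\<close>).

  The means of \<open>L\<close> are extended nonnegative reals. If some \<open>E j\<close> with \<open>j \<le> n\<close> is infinite, then so
  is its mean under \<open>Z\<close>, because \<open>Z\<close> charges every \<open>j \<le> n\<close>, and the comparison
  holds trivially; otherwise it is one between real sums.
\<close>

section \<open>Convex sequences\<close>

text \<open>Convexity is required only at triples lying entirely in \<open>I\<close>, so that it can be used for
  \<open>- ln p\<close> on the support of a mass function \<open>p\<close>, outside of which the logarithm carries no
  meaning.\<close>

definition convex_seq_on :: "nat set \<Rightarrow> (nat \<Rightarrow> real) \<Rightarrow> bool" where
  "convex_seq_on I e \<longleftrightarrow>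
     (\<forall>i. i \<in> I \<longrightarrow> i + 1 \<in> I \<longrightarrow> i + 2 \<in> I \<longrightarrow> 2 * e (i + 1) \<le> e i + e (i + 2))"

lemma convex_seq_onD:
  assumes "convex_seq_on I e" "{i..i + 2} \<subseteq> I"
  shows "2 * e (i + 1) \<le> e i + e (i + 2)"
  using assms unfolding convex_seq_on_def by (auto simp: subset_iff)

lemma convex_seq_on_increments_mono:
  assumes "convex_seq_on I e" "{i..j + 1} \<subseteq> I" "i \<le> j"
  shows "e (i + 1) - e i \<le> e (j + 1) - e j"
  using assms(3,2)
proof (induction j rule: dec_induct)
  case (step j)
  have "2 * e (j + 1) \<le> e j + e (j + 2)"
    using step by (intro convex_seq_onD[OF assms(1)]) (auto simp: subset_iff)
  moreover have "e (i + 1) - e i \<le> e (j + 1) - e j"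
    using step by (auto simp: subset_iff)
  ultimately show ?case by simp
qed simp

text \<open>The increment of \<open>e\<close> over a step of length \<open>a\<close> does not decrease when the step starts \<open>b\<close> later.\<close>

lemma convex_seq_on_exchange:
  assumes "convex_seq_on I e" "{s..s + a + b} \<subseteq> I"
  shows "e (s + a) + e (s + b) \<le> e s + e (s + a + b)"
  using assms(2)
proof (induction a)
  case (Suc a)
  have "e (s + a + 1) - e (s + a) \<le> e (s + a + b + 1) - e (s + a + b)"
    using Suc.prems by (intro convex_seq_on_increments_mono[OF assms(1)]) (auto simp: subset_iff)
  with Suc show ?case by (auto simp: subset_iff add_ac)
qed simp

text \<open>Up to \<open>j\<close> all increments are at most the one at \<open>j\<close>, and from \<open>j\<close> on all are at least it. The
  denominators are cleared, which also admits \<open>i = k\<close>.\<close>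

lemma convex_seq_on_chord:
  assumes "convex_seq_on I e" "{i..k} \<subseteq> I" "i \<le> j" "j \<le> k"
  shows "(real k - real i) * e j \<le> (real k - real j) * e i + (real j - real i) * e k"
proof (cases "i < j \<and> j < k")
  case True
  have left: "e j - e i \<le> (real j - real i) * (e (j + 1) - e j)"
  proof -
    have "e j - e i = (\<Sum>l=i..<j. e (l + 1) - e l)"
      using True by (simp add: sum_Suc_diff')
    also have "\<dots> \<le> (\<Sum>l=i..<j. e (j + 1) - e j)"
      using True assms(2)
      by (intro sum_mono convex_seq_on_increments_mono[OF assms(1)]) (auto simp: subset_iff)
    finally show ?thesis using True by (simp add: of_nat_diff)
  qed
  have right: "(real k - real j) * (e (j + 1) - e j) \<le> e k - e j"
  proof -
    have "(\<Sum>l=j..<k. e (j + 1) - e j) \<le> (\<Sum>l=j..<k. e (l + 1) - e l)"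
      using True assms(2)
      by (intro sum_mono convex_seq_on_increments_mono[OF assms(1)]) (auto simp: subset_iff)
    also have "\<dots> = e k - e j"
      using True by (simp add: sum_Suc_diff')
    finally show ?thesis using True by (simp add: of_nat_diff)
  qed
  have "(real k - real j) * (e j - e i)
      \<le> (real k - real j) * ((real j - real i) * (e (j + 1) - e j))"
    using left True by (intro mult_left_mono) auto
  also have "\<dots> = (real j - real i) * ((real k - real j) * (e (j + 1) - e j))"
    by simp
  also have "\<dots> \<le> (real j - real i) * (e k - e j)"
    using right True by (intro mult_left_mono) auto
  finally show ?thesis by (simp add: algebra_simps)
qed (use assms in \<open>auto simp: algebra_simps not_less\<close>)


section \<open>Convex order of distributions with a log-concave ratio\<close>

text \<open>Since \<open>w\<close> and \<open>z\<close> have the same mass and mean, subtracting an affine function from \<open>e\<close>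
  changes both sums equally. With the chord of \<open>e\<close> over \<open>a, b\<close> subtracted, \<open>e\<close> is at most zero between
  \<open>a\<close> and \<open>b\<close> and nonnegative outside, which are the signs of \<open>z - w\<close>. At \<open>a\<close> and \<open>b\<close> themselves
  the chord meets \<open>e\<close>, so these two terms vanish whatever the sign of \<open>z - w\<close>.\<close>

lemma two_crossings_sum_le:
  fixes w z e :: "nat \<Rightarrow> real"
  assumes cvx: "convex_seq_on {0..n} e"
    and mass: "(\<Sum>j\<le>n. w j) = (\<Sum>j\<le>n. z j)"
    and mean: "(\<Sum>j\<le>n. real j * w j) = (\<Sum>j\<le>n. real j * z j)"
    and ab: "a < b" "b \<le> n"
    and inside: "\<And>j. a < j \<Longrightarrow> j < b \<Longrightarrow> z j \<le> w j"
    and outside: "\<And>j. j \<le> n \<Longrightarrow> j < a \<or> b < j \<Longrightarrow> w j \<le> z j"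
  shows "(\<Sum>j\<le>n. w j * e j) \<le> (\<Sum>j\<le>n. z j * e j)"
proof -
  \<comment> \<open>\<open>e\<close> minus its chord, scaled by \<open>b - a\<close>\<close>
  define h where
    "h j = (real b - real a) * e j - ((real b - real j) * e a + (real j - real a) * e b)" for j
  have chord: "(real k - real i) * e j \<le> (real k - real j) * e i + (real j - real i) * e k"
    if "i \<le> j" "j \<le> k" "k \<le> n" for i j k
    using that by (intro convex_seq_on_chord[OF cvx]) auto
  have "0 \<le> (z j - w j) * h j" if "j \<le> n" for j
  proof -
    consider "j < a" | "j = a" | "a < j" "j < b" | "j = b" | "b < j" by linarith
    then show ?thesis
    proof cases
      case 1
      with chord[of j a b] ab have "0 \<le> h j" by (simp add: h_def algebra_simps)
      with outside[of j] 1 that show ?thesis by simp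
    next
      case 3
      with chord[of a j b] ab have "h j \<le> 0" by (simp add: h_def algebra_simps)
      with inside[of j] 3 show ?thesis by (simp add: mult_nonpos_nonpos)
    next
      case 5
      with chord[of a b j] ab that have "0 \<le> h j" by (simp add: h_def algebra_simps)
      with outside[of j] 5 that show ?thesis by simp
    qed (simp_all add: h_def algebra_simps)
  qed
  then have "0 \<le> (\<Sum>j\<le>n. (z j - w j) * h j)" by (intro sum_nonneg) simp
  also have "\<dots> = (\<Sum>j\<le>n. (real b - real a) * (z j * e j - w j * e j)
      - (real b * e a - real a * e b) * (z j - w j)
      - (e b - e a) * (real j * z j - real j * w j))"
    by (rule sum.cong) (simp_all add: h_def algebra_simps)
  also have "\<dots> = (real b - real a) * ((\<Sum>j\<le>n. z j * e j) - (\<Sum>j\<le>n. w j * e j))"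
    using mass mean by (simp only: sum_subtractf sum_distrib_left[symmetric]) simp
  finally show ?thesis using ab by (simp add: zero_le_mult_iff)
qed

text \<open>Log-concavity of \<open>w / z\<close> makes \<open>{j. w j \<ge> z j}\<close> an interval, and it is nonempty because the
  masses agree. Its end points serve as the two crossings.\<close>

lemma log_concave_ratio_sum_convex_le:
  fixes w z e :: "nat \<Rightarrow> real"
  assumes n: "1 \<le> n"
    and w: "\<And>j. j \<le> n \<Longrightarrow> 0 < w j" and z: "\<And>j. j \<le> n \<Longrightarrow> 0 < z j"
    and mass: "(\<Sum>j\<le>n. w j) = (\<Sum>j\<le>n. z j)"
    and mean: "(\<Sum>j\<le>n. real j * w j) = (\<Sum>j\<le>n. real j * z j)"
    and ratio: "convex_seq_on {0..n} (\<lambda>j. ln (z j) - ln (w j))"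
    and cvx: "convex_seq_on {0..n} e"
  shows "(\<Sum>j\<le>n. w j * e j) \<le> (\<Sum>j\<le>n. z j * e j)"
proof -
  define A where "A = {j. j \<le> n \<and> z j \<le> w j}"
  have fin: "finite A" by (simp add: A_def)
  have ne: "A \<noteq> {}"
  proof
    assume "A = {}"
    then have "w j < z j" if "j \<le> n" for j
      using that by (auto simp: A_def not_le[symmetric])
    then have "(\<Sum>j\<le>n. w j) < (\<Sum>j\<le>n. z j)"
      by (intro sum_strict_mono) auto
    with mass show False by simp
  qed
  define a b where "a = Min A" and "b = Max A"
  have aA: "a \<in> A" and bA: "b \<in> A" and ab: "a \<le> b"
    using fin ne by (auto simp: a_def b_def)
  have inside: "z j \<le> w j" if "a \<le> j" "j \<le> b" for j
  proof (cases "a < b")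
    case True
    have le: "ln (z a) - ln (w a) \<le> 0" "ln (z b) - ln (w b) \<le> 0"
      using aA bA z w by (auto simp: A_def)
    have "(real b - real a) * (ln (z j) - ln (w j))
        \<le> (real b - real j) * (ln (z a) - ln (w a)) + (real j - real a) * (ln (z b) - ln (w b))"
      using that bA by (intro convex_seq_on_chord[OF ratio]) (auto simp: A_def)
    also have "\<dots> \<le> 0"
      using le that by (intro add_nonpos_nonpos mult_nonneg_nonpos) auto
    finally have "ln (z j) \<le> ln (w j)"
      using True by (simp add: mult_le_0_iff)
    with w z that bA show ?thesis by (simp add: A_def)
  next
    case False
    with that ab aA have "j \<in> A" by (metis le_antisym le_less)
    then show ?thesis by (simp add: A_def)
  qed
  have outside: "w j \<le> z j" if "j \<le> n" "j < a \<or> b < j" for j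
    using that fin Min_le[of A j] Max_ge[of A j] by (fastforce simp: A_def a_def b_def not_le)
  \<comment> \<open>If the interval is a single point, any neighbour of it completes a chord: no integer lies
    strictly between the two.\<close>
  consider "a < b" | "a = b" "a < n" | "a = b" "a = n"
    using ab aA by (auto simp: A_def le_less)
  then show ?thesis
  proof cases
    case 1
    show ?thesis
      by (rule two_crossings_sum_le[OF cvx mass mean 1])
        (use bA inside outside in \<open>auto simp: A_def\<close>)
  next
    case 2
    show ?thesis
      by (rule two_crossings_sum_le[OF cvx mass mean, of a "a + 1"])
        (use 2 outside in auto)
  next
    case 3
    show ?thesis
      by (rule two_crossings_sum_le[OF cvx mass mean, of "n - 1" n])
        (use 3 n outside in auto)
  qed
qed

section \<open>Random sums\<close>

text \<open>A sum of a fixed number of terms is a random sum with a constant counting variable.\<close>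

abbreviation partial_sum :: "(nat \<Rightarrow> 'a \<Rightarrow> nat) \<Rightarrow> nat \<Rightarrow> 'a \<Rightarrow> nat" where
  "partial_sum Y j \<equiv> random_sum (\<lambda>_. j) Y"

lemma measurable_sum_nat:
  fixes f :: "'i \<Rightarrow> 'a \<Rightarrow> nat"
  assumes "\<And>i. i \<in> I \<Longrightarrow> f i \<in> measurable M (count_space UNIV)"
  shows "(\<lambda>\<omega>. \<Sum>i\<in>I. f i \<omega>) \<in> measurable M (count_space UNIV)"
  using assms
proof (induction I rule: infinite_finite_induct)
  case (insert i I)
  note [measurable] = insert.prems[of i, simplified]
  have [measurable]: "(\<lambda>\<omega>. \<Sum>i\<in>I. f i \<omega>) \<in> measurable M (count_space UNIV)"
    using insert by simp
  have "(\<lambda>\<omega>. f i \<omega> + (\<Sum>i\<in>I. f i \<omega>)) \<in> measurable M (count_space UNIV)"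
    by measurable
  with insert.hyps show ?case by simp
qed simp_all

lemma (in prob_space) iid_measurable:
  assumes "iid M Y" "1 \<le> i"
  shows "Y i \<in> measurable M (count_space UNIV)"
  using assms by (auto simp: iid_def indep_vars_def)

lemma (in prob_space) partial_sum_measurable:
  assumes "iid M Y"
  shows "partial_sum Y j \<in> measurable M (count_space UNIV)"
  unfolding random_sum_def using assms by (intro measurable_sum_nat iid_measurable) auto

text \<open>The counting variable has countably many values, so the sum may be treated as a countable case
  distinction between partial sums.\<close>

lemma (in prob_space) random_sum_measurable:
  assumes "iid M Y" "N \<in> measurable M (count_space UNIV)"
  shows "random_sum N Y \<in> measurable M (count_space UNIV)"
proof -
  have "(\<lambda>\<omega>. partial_sum Y (N \<omega>) \<omega>) \<in> measurable M (count_space UNIV)"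
    by (rule measurable_compose_countable[OF partial_sum_measurable]) (use assms in auto)
  also have "(\<lambda>\<omega>. partial_sum Y (N \<omega>) \<omega>) = random_sum N Y"
    by (auto simp: random_sum_def fun_eq_iff)
  finally show ?thesis .
qed

text \<open>Any later summand is independent of the first \<open>m\<close> of them and has the common law, so the law of
  the sum is a function of the laws of \<open>partial_sum Y m\<close> and of \<open>Y 1\<close> alone.\<close>

lemma (in prob_space) distr_partial_sum_add:
  assumes "iid M Y" "m < i"
  shows "distr M (count_space UNIV) (\<lambda>\<omega>. partial_sum Y m \<omega> + Y i \<omega>) =
         distr M (count_space UNIV) (partial_sum Y (m + 1))"
proof -
  let ?C = "count_space (UNIV :: nat set)"
  have law: "distr M ?C (\<lambda>\<omega>. partial_sum Y m \<omega> + Y l \<omega>) =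
      distr (distr M ?C (partial_sum Y m) \<Otimes>\<^sub>M distr M ?C (Y 1)) ?C (\<lambda>(a, b). a + b)"
    if "m < l" for l
  proof -
    have "indep_var (PiM {1..m} (\<lambda>_. ?C)) (\<lambda>\<omega>. restrict (\<lambda>i. Y i \<omega>) {1..m})
        (PiM {l} (\<lambda>_. ?C)) (\<lambda>\<omega>. restrict (\<lambda>i. Y i \<omega>) {l})"
      using assms(1) that by (intro indep_var_restrict[where I = "{1..}"]) (auto simp: iid_def)
    then have "indep_var
        ?C ((\<lambda>f. \<Sum>i=1..m. f i) \<circ> (\<lambda>\<omega>. restrict (\<lambda>i. Y i \<omega>) {1..m}))
        ?C ((\<lambda>f. f l) \<circ> (\<lambda>\<omega>. restrict (\<lambda>i. Y i \<omega>) {l}))"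
      by (rule indep_var_compose) (intro measurable_sum_nat measurable_component_singleton; simp)+
    also have "(\<lambda>f. \<Sum>i=1..m. f i) \<circ> (\<lambda>\<omega>. restrict (\<lambda>i. Y i \<omega>) {1..m}) = partial_sum Y m"
      by (auto simp: random_sum_def fun_eq_iff)
    also have "(\<lambda>f. f l) \<circ> (\<lambda>\<omega>. restrict (\<lambda>i. Y i \<omega>) {l}) = Y l"
      by auto
    finally have "indep_var ?C (partial_sum Y m) ?C (Y l)" .
    then have pair: "partial_sum Y m \<in> measurable M ?C" "Y l \<in> measurable M ?C"
      "distr M ?C (partial_sum Y m) \<Otimes>\<^sub>M distr M ?C (Y l)
        = distr M (?C \<Otimes>\<^sub>M ?C) (\<lambda>\<omega>. (partial_sum Y m \<omega>, Y l \<omega>))"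
      by (auto simp: indep_var_distribution_eq)
    have "distr M ?C (Y l) = distr M ?C (Y 1)"
      using assms(1)[unfolded iid_def, THEN conjunct2, rule_format, of l] that by simp
    then have "distr (distr M ?C (partial_sum Y m) \<Otimes>\<^sub>M distr M ?C (Y 1)) ?C (\<lambda>(a, b). a + b)
        = distr (distr M (?C \<Otimes>\<^sub>M ?C) (\<lambda>\<omega>. (partial_sum Y m \<omega>, Y l \<omega>))) ?C (\<lambda>(a, b). a + b)"
      using pair(3) by simp
    also have "\<dots> = distr M ?C (\<lambda>\<omega>. partial_sum Y m \<omega> + Y l \<omega>)"
      using pair(1,2) by (subst distr_distr) (simp_all add: comp_def pair_measure_countable)
    finally show ?thesis by simp
  qed
  have "(\<lambda>\<omega>. partial_sum Y m \<omega> + Y (m + 1) \<omega>) = partial_sum Y (m + 1)"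
    by (simp add: random_sum_def fun_eq_iff)
  with law[of i] law[of "m + 1"] assms(2) show ?thesis by simp
qed

text \<open>Both intermediate sums \<open>S\<^sub>m + Y\<^sub>m\<^sub>+\<^sub>1\<close> and \<open>S\<^sub>m + Y\<^sub>m\<^sub>+\<^sub>2\<close> have the law of \<open>S\<^sub>m\<^sub>+\<^sub>1\<close>, so twice its
  mean is the mean of the left-hand side of the pointwise inequality \<open>convex_seq_on_exchange\<close>. That
  inequality is available because \<open>I\<close> is an interval: it contains everything between \<open>S\<^sub>m\<close> and
  \<open>S\<^sub>m\<^sub>+\<^sub>2\<close>. Stated for extended nonnegative reals, it covers infinite means as well.\<close>

lemma (in prob_space) expectation_partial_sum_convex:
  fixes L :: "nat \<Rightarrow> real"
  assumes iid: "iid M Y"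
    and cvx: "convex_seq_on I L"
    and interval: "\<And>i k. i \<in> I \<Longrightarrow> k \<in> I \<Longrightarrow> {i..k} \<subseteq> I"
    and nonneg: "\<And>k. k \<in> I \<Longrightarrow> 0 \<le> L k"
    and supp: "AE \<omega> in M. partial_sum Y m \<omega> \<in> I" "AE \<omega> in M. partial_sum Y (m + 2) \<omega> \<in> I"
  shows "2 * (\<integral>\<^sup>+\<omega>. ennreal (L (partial_sum Y (m + 1) \<omega>)) \<partial>M)
    \<le> (\<integral>\<^sup>+\<omega>. ennreal (L (partial_sum Y m \<omega>)) \<partial>M)
      + (\<integral>\<^sup>+\<omega>. ennreal (L (partial_sum Y (m + 2) \<omega>)) \<partial>M)"
proof -
  let ?C = "count_space (UNIV :: nat set)"
  let ?F = "\<lambda>k. ennreal (L k)"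
  note [measurable] = partial_sum_measurable[OF iid]
  have Y[measurable]: "Y (m + 1) \<in> measurable M ?C" "Y (m + 2) \<in> measurable M ?C"
    using iid_measurable[OF iid] by auto
  have same: "(\<integral>\<^sup>+\<omega>. ?F (partial_sum Y (m + 1) \<omega>) \<partial>M)
      = (\<integral>\<^sup>+\<omega>. ?F (partial_sum Y m \<omega> + Y i \<omega>) \<partial>M)" if "i = m + 1 \<or> i = m + 2" for i
  proof -
    have [measurable]: "Y i \<in> measurable M ?C" using that Y by auto
    have "(\<integral>\<^sup>+\<omega>. ?F (partial_sum Y (m + 1) \<omega>) \<partial>M)
        = (\<integral>\<^sup>+k. ?F k \<partial>distr M ?C (partial_sum Y (m + 1)))"
      by (subst nn_integral_distr) auto
    also have "\<dots> = (\<integral>\<^sup>+k. ?F k \<partial>distr M ?C (\<lambda>\<omega>. partial_sum Y m \<omega> + Y i \<omega>))"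
      using that by (subst distr_partial_sum_add[OF iid]) auto
    also have "\<dots> = (\<integral>\<^sup>+\<omega>. ?F (partial_sum Y m \<omega> + Y i \<omega>) \<partial>M)"
      by (subst nn_integral_distr) auto
    finally show ?thesis .
  qed
  have "2 * (\<integral>\<^sup>+\<omega>. ?F (partial_sum Y (m + 1) \<omega>) \<partial>M)
      = (\<integral>\<^sup>+\<omega>. ?F (partial_sum Y m \<omega> + Y (m + 1) \<omega>) \<partial>M)
        + (\<integral>\<^sup>+\<omega>. ?F (partial_sum Y m \<omega> + Y (m + 2) \<omega>) \<partial>M)"
    unfolding mult_2 using same[of "m + 1"] same[of "m + 2"] by presburger
  also have "\<dots> = (\<integral>\<^sup>+\<omega>. ?F (partial_sum Y m \<omega> + Y (m + 1) \<omega>)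
      + ?F (partial_sum Y m \<omega> + Y (m + 2) \<omega>) \<partial>M)"
    by (rule nn_integral_add[symmetric]) measurable
  also have "\<dots> \<le> (\<integral>\<^sup>+\<omega>. ?F (partial_sum Y m \<omega>) + ?F (partial_sum Y (m + 2) \<omega>) \<partial>M)"
  proof (rule nn_integral_mono_AE)
    show "AE \<omega> in M. ?F (partial_sum Y m \<omega> + Y (m + 1) \<omega>) + ?F (partial_sum Y m \<omega> + Y (m + 2) \<omega>)
        \<le> ?F (partial_sum Y m \<omega>) + ?F (partial_sum Y (m + 2) \<omega>)"
      using supp
    proof eventually_elim
      case (elim \<omega>)
      define s a b where "s = partial_sum Y m \<omega>" and "a = Y (m + 1) \<omega>" and "b = Y (m + 2) \<omega>"
      have end_eq: "partial_sum Y (m + 2) \<omega> = s + a + b"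
        by (simp add: s_def a_def b_def random_sum_def)
      have sub: "{s..s + a + b} \<subseteq> I"
        using interval[OF elim] by (simp only: end_eq s_def)
      then have mem: "s \<in> I" "s + a \<in> I" "s + b \<in> I" "s + a + b \<in> I"
        by (auto simp: subset_iff)
      have "?F (s + a) + ?F (s + b) \<le> ?F s + ?F (s + a + b)"
        using convex_seq_on_exchange[OF cvx sub] mem[THEN nonneg]
        by (simp add: ennreal_plus[symmetric] ennreal_leI del: ennreal_plus)
      then show ?case by (simp only: end_eq s_def a_def b_def)
    qed
  qed
  also have "\<dots> = (\<integral>\<^sup>+\<omega>. ?F (partial_sum Y m \<omega>) \<partial>M) + (\<integral>\<^sup>+\<omega>. ?F (partial_sum Y (m + 2) \<omega>) \<partial>M)"
    by (rule nn_integral_add) measurable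
  finally show ?thesis .
qed

lemma (in prob_space) nn_integral_nat_valued:
  fixes F :: "nat \<Rightarrow> ennreal"
  assumes [measurable]: "X \<in> measurable M (count_space UNIV)"
  shows "(\<integral>\<^sup>+\<omega>. F (X \<omega>) \<partial>M) = (\<Sum>k. ennreal (\<P>(\<omega> in M. X \<omega> = k)) * F k)"
proof -
  have "(\<integral>\<^sup>+\<omega>. F (X \<omega>) \<partial>M)
      = (\<integral>\<^sup>+\<omega>. (\<Sum>k. F k * indicator {\<omega>\<in>space M. X \<omega> = k} \<omega>) \<partial>M)"
  proof (rule nn_integral_cong)
    fix \<omega> assume "\<omega> \<in> space M"
    then have "(\<Sum>k. F k * indicator {\<omega>\<in>space M. X \<omega> = k} \<omega>)
        = (\<Sum>k\<in>{X \<omega>}. F k * indicator {\<omega>\<in>space M. X \<omega> = k} \<omega>)"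
      by (intro suminf_finite) (auto simp: indicator_def)
    with \<open>\<omega> \<in> space M\<close> show "F (X \<omega>) = (\<Sum>k. F k * indicator {\<omega>\<in>space M. X \<omega> = k} \<omega>)"
      by simp
  qed
  also have "\<dots> = (\<Sum>k. \<integral>\<^sup>+\<omega>. F k * indicator {\<omega>\<in>space M. X \<omega> = k} \<omega> \<partial>M)"
    by (rule nn_integral_suminf) measurable
  also have "\<dots> = (\<Sum>k. ennreal (\<P>(\<omega> in M. X \<omega> = k)) * F k)"
    by (simp add: nn_integral_cmult_indicator emeasure_eq_measure mult.commute)
  finally show ?thesis .
qed

lemma in_support_iff: "k \<in> support M X \<longleftrightarrow> 0 < \<P>(\<omega> in M. X \<omega> = k)"
  by (simp add: support_def)

lemma (in prob_space) AE_in_support: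
  assumes [measurable]: "X \<in> measurable M (count_space UNIV)"
  shows "AE \<omega> in M. X \<omega> \<in> support M X"
proof -
  have "AE \<omega> in M. X \<omega> \<noteq> k" if "k \<notin> support M X" for k
  proof -
    have "\<P>(\<omega> in M. X \<omega> = k) = 0"
      using that by (simp add: support_def zero_less_measure_iff)
    then show ?thesis
      by (subst (asm) prob_Collect_eq_0) measurable
  qed
  then have "AE \<omega> in M. \<forall>k. k \<notin> support M X \<longrightarrow> X \<omega> \<noteq> k"
    by (subst AE_all_countable) simp
  then show ?thesis by eventually_elim auto
qed

text \<open>Independence of the counting variable from the whole sequence is used on the event that the
  first \<open>j\<close> coordinates of the sequence add up to \<open>k\<close>.\<close>

lemma (in prob_space) random_sum_pmf:
  assumes iid: "iid M Y" and N[measurable]: "N \<in> measurable M (count_space UNIV)"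
    and indep: "indep_of_seq M N Y"
    and bound: "support M N \<subseteq> {0..n}"
  shows "\<P>(\<omega> in M. random_sum N Y \<omega> = k)
    = (\<Sum>j\<le>n. \<P>(\<omega> in M. N \<omega> = j) * \<P>(\<omega> in M. partial_sum Y j \<omega> = k))"
proof -
  let ?C = "count_space (UNIV :: nat set)"
  note [measurable] = partial_sum_measurable[OF iid] random_sum_measurable[OF iid N]
  have le: "AE \<omega> in M. N \<omega> \<le> n"
    using AE_in_support[OF N] by eventually_elim (use bound in auto)
  have prod: "prob {\<omega>\<in>space M. N \<omega> = j \<and> partial_sum Y j \<omega> = k}
      = \<P>(\<omega> in M. N \<omega> = j) * \<P>(\<omega> in M. partial_sum Y j \<omega> = k)" for j
  proof -
    let ?P = "PiM {1..} (\<lambda>_. ?C)" and ?Y = "\<lambda>\<omega>. \<lambda>i\<in>{1..}. Y i \<omega>"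
    define A where "A = {y\<in>space ?P. (\<Sum>i=1..j. y i) = k}"
    have "(\<lambda>y. \<Sum>i=1..j. y i) \<in> measurable ?P ?C"
      by (intro measurable_sum_nat measurable_component_singleton) auto
    then have A: "A \<in> sets ?P"
      unfolding A_def by measurable
    have "?Y \<in> measurable M ?P"
      using indep by (auto simp: indep_of_seq_def indep_rv_def)
    then have sum_eq: "?Y -` A \<inter> space M = {\<omega>\<in>space M. partial_sum Y j \<omega> = k}"
      by (auto simp: A_def random_sum_def dest: measurable_space)
    have "prob ((N -` {j} \<inter> space M) \<inter> (?Y -` A \<inter> space M))
        = prob (N -` {j} \<inter> space M) * prob (?Y -` A \<inter> space M)"
      using indep A unfolding indep_of_seq_def indep_rv_def
      by (intro indep_setD[of "sigma_sets (space M) {N -` A \<inter> space M | A. A \<in> sets ?C}"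
            "sigma_sets (space M) {?Y -` A \<inter> space M | A. A \<in> sets ?P}"])
        (auto intro!: sigma_sets.Basic)
    moreover have "N -` {j} \<inter> space M = {\<omega>\<in>space M. N \<omega> = j}" by auto
    moreover have "{\<omega>\<in>space M. N \<omega> = j} \<inter> {\<omega>\<in>space M. partial_sum Y j \<omega> = k}
        = {\<omega>\<in>space M. N \<omega> = j \<and> partial_sum Y j \<omega> = k}" by auto
    ultimately show ?thesis by (simp only: sum_eq)
  qed
  have "prob {\<omega>\<in>space M. random_sum N Y \<omega> = k}
      = prob (\<Union>j\<in>{..n}. {\<omega>\<in>space M. N \<omega> = j \<and> partial_sum Y j \<omega> = k})"
  proof (rule finite_measure_eq_AE)
    show "AE \<omega> in M. \<omega> \<in> {\<omega>\<in>space M. random_sum N Y \<omega> = k} \<longleftrightarrow>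
        \<omega> \<in> (\<Union>j\<in>{..n}. {\<omega>\<in>space M. N \<omega> = j \<and> partial_sum Y j \<omega> = k})"
      using le by eventually_elim (auto simp: random_sum_def)
  qed measurable
  also have "\<dots> = (\<Sum>j\<le>n. prob {\<omega>\<in>space M. N \<omega> = j \<and> partial_sum Y j \<omega> = k})"
    by (intro finite_measure_finite_Union) (auto simp: disjoint_family_on_def)
  finally show ?thesis by (simp add: prod)
qed

text \<open>In particular the support of a random sum depends on the counting variable only through its
  support, so the sums over \<open>W\<close> and over \<open>Z\<close> have the same one.\<close>

lemma (in prob_space) support_random_sum:
  assumes "iid M Y" "N \<in> measurable M (count_space UNIV)" "indep_of_seq M N Y"
    and "support M N = {0..n}"
  shows "support M (random_sum N Y) = (\<Union>j\<le>n. support M (partial_sum Y j))"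
proof (rule set_eqI)
  fix k
  let ?p = "\<lambda>j. \<P>(\<omega> in M. N \<omega> = j) * \<P>(\<omega> in M. partial_sum Y j \<omega> = k)"
  have pos: "0 < \<P>(\<omega> in M. N \<omega> = j)" if "j \<le> n" for j
    using assms(4) that by (simp flip: in_support_iff)
  have "k \<in> support M (random_sum N Y) \<longleftrightarrow> 0 < (\<Sum>j\<le>n. ?p j)"
    using assms by (simp add: support_def random_sum_pmf[of Y N n])
  also have "\<dots> \<longleftrightarrow> (\<exists>j\<le>n. 0 < ?p j)"
    using sum_nonneg_eq_0_iff[of "{..n}" ?p] sum_nonneg[of "{..n}" ?p]
    by (auto simp: less_le)
  also have "\<dots> \<longleftrightarrow> k \<in> (\<Union>j\<le>n. support M (partial_sum Y j))"
    using pos by (auto simp: support_def zero_less_mult_iff)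
  finally show "k \<in> support M (random_sum N Y) \<longleftrightarrow> k \<in> (\<Union>j\<le>n. support M (partial_sum Y j))" .
qed

lemma (in prob_space) expectation_random_sum:
  fixes F :: "nat \<Rightarrow> ennreal"
  assumes "iid M Y" "N \<in> measurable M (count_space UNIV)" "indep_of_seq M N Y"
    and "support M N \<subseteq> {0..n}"
  shows "(\<Sum>k. ennreal (\<P>(\<omega> in M. random_sum N Y \<omega> = k)) * F k)
    = (\<Sum>j\<le>n. ennreal (\<P>(\<omega> in M. N \<omega> = j)) * (\<integral>\<^sup>+\<omega>. F (partial_sum Y j \<omega>) \<partial>M))"
proof -
  have "(\<Sum>k. ennreal (\<P>(\<omega> in M. random_sum N Y \<omega> = k)) * F k)
    = (\<Sum>k. \<Sum>j\<le>n. ennreal (\<P>(\<omega> in M. N \<omega> = j))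
        * (ennreal (\<P>(\<omega> in M. partial_sum Y j \<omega> = k)) * F k))"
    by (simp add: random_sum_pmf[OF assms] sum_distrib_right ennreal_mult mult.assoc
        flip: sum_ennreal)
  also have "\<dots> = (\<Sum>j\<le>n. \<Sum>k. ennreal (\<P>(\<omega> in M. N \<omega> = j))
        * (ennreal (\<P>(\<omega> in M. partial_sum Y j \<omega> = k)) * F k))"
    by (rule suminf_sum) simp
  also have "\<dots> = (\<Sum>j\<le>n. ennreal (\<P>(\<omega> in M. N \<omega> = j)) * (\<integral>\<^sup>+\<omega>. F (partial_sum Y j \<omega>) \<partial>M))"
    by (simp add: nn_integral_nat_valued[OF partial_sum_measurable[OF assms(1)]])
  finally show ?thesis .
qed

section \<open>Entropy and cross entropy\<close>

lemma (in prob_space) entropy_nat_eq: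
  "entropy_nat M X
    = (\<Sum>k. ennreal (\<P>(\<omega> in M. X \<omega> = k)) * ennreal (- ln (\<P>(\<omega> in M. X \<omega> = k))))"
  unfolding entropy_nat_def
  by (intro suminf_cong) (simp add: ennreal_mult'[symmetric])

text \<open>This is Gibbs' inequality, from \<open>ln x \<le> x - 1\<close> at \<open>x = g k / f k\<close>. To stay within nonnegative
  terms, the inequality is summed in the form
  \<open>- f ln f + f \<le> - f ln g + g\<close>, and the total masses, both equal to 1, are cancelled afterwards. The
  inclusion of supports excludes the terms with \<open>f k > 0 = g k\<close>, where the value \<open>ln 0 = 0\<close> would
  make the right-hand side too small.\<close>

lemma (in prob_space) entropy_nat_le_cross_entropy:
  assumes X: "X \<in> measurable M (count_space UNIV)" and X': "X' \<in> measurable M (count_space UNIV)"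
    and supp: "support M X \<subseteq> support M X'"
  shows "entropy_nat M X
    \<le> (\<Sum>k. ennreal (\<P>(\<omega> in M. X \<omega> = k)) * ennreal (- ln (\<P>(\<omega> in M. X' \<omega> = k))))"
proof -
  define f g where "f k = \<P>(\<omega> in M. X \<omega> = k)" and "g k = \<P>(\<omega> in M. X' \<omega> = k)" for k
  have range: "0 \<le> f k" "f k \<le> 1" "0 \<le> g k" "g k \<le> 1" for k
    by (auto simp: f_def g_def)
  have mass: "(\<Sum>k. ennreal (f k)) = 1" "(\<Sum>k. ennreal (g k)) = 1"
    using nn_integral_nat_valued[OF X, of "\<lambda>_. 1"] nn_integral_nat_valued[OF X', of "\<lambda>_. 1"]
    by (simp_all add: f_def g_def emeasure_space_1)
  have term_le: "ennreal (f k) * ennreal (- ln (f k)) + ennreal (f k)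
      \<le> ennreal (f k) * ennreal (- ln (g k)) + ennreal (g k)" for k
  proof (cases "f k = 0")
    case False
    then have f: "0 < f k" using range[of k] by simp
    then have g: "0 < g k" using supp by (auto simp: support_def f_def g_def)
    have "ln (g k) - ln (f k) \<le> g k / f k - 1"
      using ln_le_minus_one[of "g k / f k"] f g by (simp add: ln_div)
    then have "f k * (ln (g k) - ln (f k)) \<le> f k * (g k / f k - 1)"
      using f by (intro mult_left_mono) auto
    then have "f k * (- ln (f k)) + f k \<le> f k * (- ln (g k)) + g k"
      using f by (simp add: algebra_simps)
    moreover have "0 \<le> - ln (f k)" "0 \<le> - ln (g k)"
      using f g range[of k] by auto
    ultimately show ?thesis
      using range[of k] mult_nonneg_nonneg[of "f k" "- ln (f k)"] mult_nonneg_nonneg[of "f k" "- ln (g k)"]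
      by (simp add: ennreal_mult[symmetric] ennreal_plus[symmetric] ennreal_leI del: ennreal_plus)
  qed simp
  have "entropy_nat M X + 1 = (\<Sum>k. ennreal (f k) * ennreal (- ln (f k)) + ennreal (f k))"
    by (simp add: entropy_nat_eq suminf_add[symmetric] mass f_def[symmetric])
  also have "\<dots> \<le> (\<Sum>k. ennreal (f k) * ennreal (- ln (g k)) + ennreal (g k))"
    by (intro suminf_le term_le) auto
  also have "\<dots> = (\<Sum>k. ennreal (f k) * ennreal (- ln (g k))) + 1"
    by (simp add: suminf_add[symmetric] mass)
  finally show ?thesis
    by (simp add: add.commute[of _ 1] ennreal_add_left_cancel_le f_def g_def)
qed

section \<open>Comparison of the counting variables\<close>

lemma sum_of_nat_binomial_pmf:
  fixes r :: real
  shows "(\<Sum>j\<le>n. real j * (real (n choose j) * r ^ j * (1 - r) ^ (n - j))) = real n * r"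
  using sum_k_Bernstein[of n r] by (simp add: Bernstein_def)

lemma (in prob_space) prob_binomial:
  assumes [measurable]: "Z \<in> measurable M (count_space UNIV)"
    and "distr M (count_space UNIV) Z = measure_pmf (binomial_pmf n r)"
    and "0 \<le> r" "r \<le> 1"
  shows "\<P>(\<omega> in M. Z \<omega> = j) = real (n choose j) * r ^ j * (1 - r) ^ (n - j)"
proof -
  have "\<P>(\<omega> in M. Z \<omega> = j) = measure (distr M (count_space UNIV) Z) {j}"
    by (subst measure_distr) (auto intro!: arg_cong[where f = prob])
  also have "\<dots> = pmf (binomial_pmf n r) j"
    by (simp add: assms(2) measure_pmf_single)
  finally show ?thesis using assms by simp
qed

lemma (in prob_space) expectation_nat_valued:
  fixes F :: "nat \<Rightarrow> real"
  assumes [measurable]: "X \<in> measurable M (count_space UNIV)" and supp: "support M X \<subseteq> {0..n}"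
  shows "expectation (\<lambda>\<omega>. F (X \<omega>)) = (\<Sum>j\<le>n. F j * \<P>(\<omega> in M. X \<omega> = j))"
proof -
  have "expectation (\<lambda>\<omega>. F (X \<omega>))
      = expectation (\<lambda>\<omega>. \<Sum>j\<le>n. F j * indicator {\<omega>\<in>space M. X \<omega> = j} \<omega>)"
  proof (rule integral_cong_AE)
    show "AE \<omega> in M. F (X \<omega>) = (\<Sum>j\<le>n. F j * indicator {\<omega>\<in>space M. X \<omega> = j} \<omega>)"
      using AE_in_support[OF assms(1)] AE_space
    proof eventually_elim
      case (elim \<omega>)
      with supp have "X \<omega> \<le> n" by auto
      have "(\<Sum>j\<le>n. F j * indicator {\<omega>\<in>space M. X \<omega> = j} \<omega>) = (\<Sum>j\<le>n. if j = X \<omega> then F j else 0)"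
        using elim by (intro sum.cong) (auto simp: indicator_def)
      with \<open>X \<omega> \<le> n\<close> show ?case by simp
    qed
  qed measurable
  also have "\<dots> = (\<Sum>j\<le>n. F j * \<P>(\<omega> in M. X \<omega> = j))"
    by (subst Bochner_Integration.integral_sum) (auto simp: emeasure_eq_measure)
  finally show ?thesis .
qed

text \<open>The binomial mass function divided by \<open>n choose j\<close> is a geometric sequence in \<open>j\<close>, so its
  logarithm is affine. Ultra log-concavity of \<open>W\<close> is therefore log-concavity of the ratio of the mass
  functions of \<open>W\<close> and \<open>Z\<close>.\<close>

lemma (in prob_space) ULC_sum_convex_le_binomial:
  assumes n: "1 \<le> n"
    and W: "W \<in> measurable M (count_space UNIV)" and Z: "Z \<in> measurable M (count_space UNIV)"
    and ulc: "ULC M n W"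
    and suppW: "support M W = {0..n}"
    and mean: "expectation (\<lambda>\<omega>. real (W \<omega>)) = real n * r" and pos: "0 < real n * r"
    and binomial: "distr M (count_space UNIV) Z = measure_pmf (binomial_pmf n r)"
  shows "support M Z = {0..n}"
    and "convex_seq_on {0..n} e \<Longrightarrow>
      (\<Sum>j\<le>n. \<P>(\<omega> in M. W \<omega> = j) * e j) \<le> (\<Sum>j\<le>n. \<P>(\<omega> in M. Z \<omega> = j) * e j)"
proof -
  define w where "w j = \<P>(\<omega> in M. W \<omega> = j)" for j
  define z where "z j = \<P>(\<omega> in M. Z \<omega> = j)" for j
  have w_pos: "0 < w j" if "j \<le> n" for j
    using suppW that by (simp add: w_def flip: in_support_iff)
  have w_mass: "(\<Sum>j\<le>n. w j) = 1"
    using expectation_nat_valued[OF W, of n "\<lambda>_. 1"] suppW by (simp add: w_def prob_space)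
  have w_mean: "(\<Sum>j\<le>n. real j * w j) = real n * r"
    using expectation_nat_valued[OF W, of n real] suppW mean by (simp add: w_def)
  have r0: "0 < r" using pos by (simp add: zero_less_mult_iff)
  \<comment> \<open>\<open>W\<close> takes the value 0 with positive probability, so its mean is strictly below \<open>n\<close>.\<close>
  have "(\<Sum>j\<le>n. real j * w j) < (\<Sum>j\<le>n. real n * w j)"
    using n w_pos[of 0] by (intro sum_strict_mono_ex1)
      (auto intro!: mult_right_mono less_imp_le[OF w_pos] bexI[of _ 0])
  then have r1: "r < 1"
    using n by (simp add: w_mean w_mass flip: sum_distrib_left)
  have z_eq: "z j = real (n choose j) * r ^ j * (1 - r) ^ (n - j)" for j
    unfolding z_def using prob_binomial[OF Z binomial] r0 r1 by simp
  have z_pos: "0 < z j" if "j \<le> n" for j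
    using that r0 r1 by (simp add: z_eq zero_less_binomial)
  have z_zero: "z j = 0" if "n < j" for j
    using that by (simp add: z_eq)
  have suppZ: "support M Z = {0..n}"
  proof -
    have "0 < z j \<longleftrightarrow> j \<le> n" for j
      using z_pos[of j] z_zero[of j] by (cases "j \<le> n") simp_all
    then have "j \<in> support M Z \<longleftrightarrow> j \<le> n" for j
      unfolding in_support_iff z_def .
    then show ?thesis by (simp add: set_eq_iff)
  qed
  show "support M Z = {0..n}" by (rule suppZ)
  have z_mass: "(\<Sum>j\<le>n. z j) = 1"
    using expectation_nat_valued[OF Z, of n "\<lambda>_. 1"] suppZ by (simp add: z_def prob_space)
  have z_mean: "(\<Sum>j\<le>n. real j * z j) = real n * r"
    unfolding z_eq by (rule sum_of_nat_binomial_pmf)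
  have ratio: "convex_seq_on {0..n} (\<lambda>j. ln (z j) - ln (w j))"
    unfolding convex_seq_on_def
  proof (intro allI impI)
    fix i assume "i + 2 \<in> {0..n}"
    then have i: "i + 2 \<le> n" by simp
    \<comment> \<open>the sequence that ultra log-concavity declares log-concave\<close>
    define c where "c j = w j / real (n choose j)" for j
    have c_pos: "0 < c j" if "j \<le> n" for j
      using that w_pos by (simp add: c_def zero_less_binomial)
    have "c i * c (i + 2) \<le> (c (i + 1))\<^sup>2"
      using ulc i by (simp add: ULC_def c_def w_def power_divide)
    then have "ln (c i * c (i + 2)) \<le> ln ((c (i + 1))\<^sup>2)"
      using c_pos[of i] c_pos[of "i + 1"] c_pos[of "i + 2"] i by (subst ln_le_cancel_iff) auto
    then have c_concave: "ln (c i) + ln (c (i + 2)) \<le> 2 * ln (c (i + 1))"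
      using c_pos[of i] c_pos[of "i + 1"] c_pos[of "i + 2"] i by (simp add: ln_mult ln_realpow)
    have split: "ln (z j) - ln (w j) = real j * ln r + (real n - real j) * ln (1 - r) - ln (c j)"
      if "j \<le> n" for j
    proof -
      have "0 < real (n choose j)" using that by (simp add: zero_less_binomial)
      then show ?thesis
        using that r0 r1 w_pos[OF that]
        by (simp add: z_eq c_def ln_mult ln_div ln_realpow of_nat_diff)
    qed
    show "2 * (ln (z (i + 1)) - ln (w (i + 1)))
        \<le> ln (z i) - ln (w i) + (ln (z (i + 2)) - ln (w (i + 2)))"
      using i c_concave by (simp add: split algebra_simps)
  qed
  show "(\<Sum>j\<le>n. \<P>(\<omega> in M. W \<omega> = j) * e j) \<le> (\<Sum>j\<le>n. \<P>(\<omega> in M. Z \<omega> = j) * e j)"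
    if "convex_seq_on {0..n} e"
    using log_concave_ratio_sum_convex_le[OF n w_pos z_pos _ _ ratio that]
    by (simp add: w_mass z_mass w_mean z_mean w_def[symmetric] z_def[symmetric])
qed

section \<open>The entropy comparison\<close>

lemma (in prob_space) log_concave_imp_convex_neg_ln:
  assumes "log_concave M X"
  shows "convex_seq_on (support M X) (\<lambda>k. - ln (\<P>(\<omega> in M. X \<omega> = k)))"
  unfolding convex_seq_on_def
proof (intro allI impI)
  define g where "g k = \<P>(\<omega> in M. X \<omega> = k)" for k
  fix i assume "i \<in> support M X" "i + 1 \<in> support M X" "i + 2 \<in> support M X"
  then have g: "0 < g i" "0 < g (i + 1)" "0 < g (i + 2)"
    by (simp_all add: support_def g_def)
  \<comment> \<open>the defining inequality at \<open>i + 1\<close>, where the truncated subtraction is exact\<close>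
  have "g (i + 1 - 1) * g (i + 1 + 1) \<le> (g (i + 1))\<^sup>2"
    unfolding g_def using assms[unfolded log_concave_def, THEN conjunct2, rule_format, of "i + 1"] by simp
  then have "ln (g i * g (i + 2)) \<le> ln ((g (i + 1))\<^sup>2)"
    using g by simp
  then show "2 * - ln (\<P>(\<omega> in M. X \<omega> = i + 1))
      \<le> - ln (\<P>(\<omega> in M. X \<omega> = i)) + - ln (\<P>(\<omega> in M. X \<omega> = i + 2))"
    using g by (simp add: ln_mult ln_realpow flip: g_def)
qed

theorem corollary4p4:
  fixes M :: "'a measure"
    and W Z :: "'a \<Rightarrow> nat"
    and Y :: "nat \<Rightarrow> 'a \<Rightarrow> nat"
    and n :: nat
    and r :: real
  assumes "prob_space M"
    and "n \<ge> 1"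
    and "W \<in> measurable M (count_space UNIV)"
    and "Z \<in> measurable M (count_space UNIV)"
    and "ULC M n W"
    and "support M W = {0..n}"
    and "prob_space.expectation M (\<lambda>\<omega>. real (W \<omega>)) = real n * r"
    and "real n * r > 0"
    and "distr M (count_space UNIV) Z = measure_pmf (binomial_pmf n r)"
    and "iid M Y"
    and "indep_of_seq M W Y"
    and "indep_of_seq M Z Y"
    and "log_concave M (random_sum Z Y)"
  shows "entropy_nat M (random_sum W Y) \<le> entropy_nat M (random_sum Z Y)"
proof -
  interpret prob_space M by fact
  note iid = \<open>iid M Y\<close> and suppW = \<open>support M W = {0..n}\<close>
  note compare = ULC_sum_convex_le_binomial[OF assms(2-9)]
  note suppZ = compare(1)
  define I where "I = support M (random_sum Z Y)"
  define L where "L k = - ln (\<P>(\<omega> in M. random_sum Z Y \<omega> = k))" for k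
  define E where "E j = (\<integral>\<^sup>+\<omega>. ennreal (L (partial_sum Y j \<omega>)) \<partial>M)" for j
  have I_W: "support M (random_sum W Y) = (\<Union>j\<le>n. support M (partial_sum Y j))"
    using support_random_sum[OF iid assms(3,11)] suppW by simp
  have I_Z: "I = (\<Union>j\<le>n. support M (partial_sum Y j))"
    unfolding I_def using support_random_sum[OF iid assms(4,12)] suppZ by simp
  have L_convex: "convex_seq_on I L"
    unfolding I_def L_def by (rule log_concave_imp_convex_neg_ln) fact
  have L_nonneg: "0 \<le> L k" if "k \<in> I" for k
    using that by (simp add: I_def L_def support_def)
  have interval: "{i..k} \<subseteq> I" if "i \<in> I" "k \<in> I" for i k
    using that assms(13) unfolding log_concave_def I_def by blast
  have S_in_I: "AE \<omega> in M. partial_sum Y j \<omega> \<in> I" if "j \<le> n" for j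
    using AE_in_support[OF partial_sum_measurable[OF iid, of j]]
    by eventually_elim (use that I_Z in auto)
  have E_convex: "2 * E (j + 1) \<le> E j + E (j + 2)" if "j + 2 \<le> n" for j
    unfolding E_def using that
    by (intro expectation_partial_sum_convex[OF iid L_convex interval L_nonneg] S_in_I) auto
  have "entropy_nat M (random_sum W Y)
      \<le> (\<Sum>k. ennreal (\<P>(\<omega> in M. random_sum W Y \<omega> = k)) * ennreal (L k))"
    unfolding L_def using I_W I_Z assms(3,4) iid
    by (intro entropy_nat_le_cross_entropy random_sum_measurable) (auto simp: I_def)
  also have "\<dots> = (\<Sum>j\<le>n. ennreal (\<P>(\<omega> in M. W \<omega> = j)) * E j)"
    unfolding E_def by (rule expectation_random_sum[OF iid assms(3,11)]) (simp add: suppW)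
  also have "\<dots> \<le> (\<Sum>j\<le>n. ennreal (\<P>(\<omega> in M. Z \<omega> = j)) * E j)"
  proof (cases "\<exists>j\<le>n. E j = \<infinity>")
    case True
    then obtain j where j: "j \<le> n" "E j = \<infinity>" by auto
    have "0 < \<P>(\<omega> in M. Z \<omega> = j)"
      using suppZ j(1) by (simp flip: in_support_iff)
    with j have "ennreal (\<P>(\<omega> in M. Z \<omega> = j)) * E j = \<infinity>"
      by (simp add: ennreal_mult_top)
    moreover have "ennreal (\<P>(\<omega> in M. Z \<omega> = j)) * E j
        \<le> (\<Sum>j\<le>n. ennreal (\<P>(\<omega> in M. Z \<omega> = j)) * E j)"
      using j(1) by (intro member_le_sum) auto
    ultimately have "(\<Sum>j\<le>n. ennreal (\<P>(\<omega> in M. Z \<omega> = j)) * E j) = \<infinity>"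
      by (simp only: infinity_ennreal_def top_unique)
    then show ?thesis by (simp only: infinity_ennreal_def top_greatest)
  next
    case False
    define e where "e j = enn2real (E j)" for j
    have E_eq: "E j = ennreal (e j)" if "j \<le> n" for j
      using False that by (auto simp: e_def less_top)
    have e_nonneg: "0 \<le> e j" for j by (simp add: e_def)
    have "convex_seq_on {0..n} e"
      unfolding convex_seq_on_def
    proof (intro allI impI)
      fix j assume "j + 2 \<in> {0..n}"
      then have "2 * ennreal (e (j + 1)) \<le> ennreal (e j) + ennreal (e (j + 2))"
        using E_convex[of j] by (simp add: E_eq)
      also have "2 * ennreal (e (j + 1)) = ennreal (2 * e (j + 1))"
        by (simp add: ennreal_mult')
      also have "ennreal (e j) + ennreal (e (j + 2)) = ennreal (e j + e (j + 2))"
        using e_nonneg by simp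
      finally show "2 * e (j + 1) \<le> e j + e (j + 2)"
        using e_nonneg[of j] e_nonneg[of "j + 2"] by (subst (asm) ennreal_le_iff) auto
    qed
    then have "(\<Sum>j\<le>n. \<P>(\<omega> in M. W \<omega> = j) * e j) \<le> (\<Sum>j\<le>n. \<P>(\<omega> in M. Z \<omega> = j) * e j)"
      by (rule compare(2))
    moreover have "(\<Sum>j\<le>n. ennreal (\<P>(\<omega> in M. X \<omega> = j)) * E j)
        = ennreal (\<Sum>j\<le>n. \<P>(\<omega> in M. X \<omega> = j) * e j)" for X :: "'a \<Rightarrow> nat"
    proof -
      have "(\<Sum>j\<le>n. ennreal (\<P>(\<omega> in M. X \<omega> = j)) * E j)
          = (\<Sum>j\<le>n. ennreal (\<P>(\<omega> in M. X \<omega> = j) * e j))"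
        using e_nonneg by (intro sum.cong) (simp_all add: E_eq ennreal_mult)
      also have "\<dots> = ennreal (\<Sum>j\<le>n. \<P>(\<omega> in M. X \<omega> = j) * e j)"
        using e_nonneg by (intro sum_ennreal) simp
      finally show ?thesis .
    qed
    ultimately show ?thesis by (simp only: ennreal_leI)
  qed
  also have "\<dots> = (\<Sum>k. ennreal (\<P>(\<omega> in M. random_sum Z Y \<omega> = k)) * ennreal (L k))"
    unfolding E_def by (rule expectation_random_sum[OF iid assms(4,12), symmetric]) (simp add: suppZ)
  also have "\<dots> = entropy_nat M (random_sum Z Y)"
    unfolding L_def by (rule entropy_nat_eq[symmetric])
  finally show ?thesis .
qed

end
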